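(* Let $\mathcal{H}$ be a separable Hilbert space, let $\varepsilon\in[0,1)$, let $\Phi=(\phi_n)_{n\in I}$ be a frame for $\mathcal{H}$ with upper frame bound $B_\Phi$, and let $\Psi=(\psi_n)_{n\in I}$ be a frame for $\mathcal{H}$ with upper frame bound $B_\Psi$ which is an $\varepsilon$-approximate dual frame of $\Phi$. Let $m=(m_n)_{n\in I}$ be a sequence of complex numbers such that $$\lambda:=\sup_{n}|m_n-1|<\frac{1-\varepsilon}{\sqrt{B_\Phi B_\Psi}}.$$ Let $M$ denote any one of the multipliers $M_{m,\Phi,\Psi}$ and $M_{m,\Psi,\Phi}$. Then $M$ is invertible on $\mathcal{H}$, $$\frac{1}{1+\lambda\sqrt{B_\Phi B_\Psi}+\varepsilon}\,\|h\|\le \|M^{-1}h\|\le \frac{1}{1-\lambda\sqrt{B_\Phi B_\Psi}-\varepsilon}\,\|h\|,\qquad \forall h\in\mathcal{H},$$ $$M^{-1}=\sum_{k=0}^\infty (\mathrm{Id}-M)^k,$$ where $\mathrm{Id}$ is the identity operator on $\mathcal{H}$, and for every $n\in\mathbb{N}\cup\{0\}$ the $n$-term error satisfies $$\Big\|M^{-1}-\sum_{k=0}^n(\mathrm{Id}-M)^k\Big\|\le \frac{\left(\lambda\sqrt{B_\Phi B_\Psi}+\varepsilon\right)^{n+1}}{1-\lambda\sqrt{B_\Phi B_\Psi}-\varepsilon}.$$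
   Context: $I$ is a countable index set. A sequence $\Phi=(\phi_n)_{n\in I}$ in $\mathcal{H}$ is a frame for $\mathcal{H}$ with bounds $A_\Phi,B_\Phi\in(0,\infty)$ if $A_\Phi\|f\|^2\le\sum_{n\in I}|\langle f,\phi_n\rangle|^2\le B_\Phi\|f\|^2$ for all $f\in\mathcal{H}$. Given a frame $\Phi$ for $\mathcal{H}$, a frame $\Psi=(\psi_n)_{n\in I}$ for $\mathcal{H}$ is called an $\varepsilon$-approximate dual frame of $\Phi$ if $\left\|\sum_{n\in I}\langle f,\phi_n\rangle\psi_n-f\right\|\le\varepsilon\|f\|$ for all $f\in\mathcal{H}$. For a complex sequence $m=(m_n)_{n\in I}$ and sequences $\Phi,\Psi$ in $\mathcal{H}$, the multiplier $M_{m,\Phi,\Psi}$ is the operator $M_{m,\Phi,\Psi}f=\sum_{n\in I} m_n\langle f,\psi_n\rangle\phi_n$, defined on those $f\in\mathcal{H}$ for which the series converges. An operator $F:\mathcal{H}\to\mathcal{H}$ is called invertible on $\mathcal{H}$ if it is a bounded bijective operator from $\mathcal{H}$ onto $\mathcal{H}$. *)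

theory Defs
  imports "HOL-Analysis.Analysis"
begin

section \<open>Complex Hilbert spaces\<close>

text \<open>The library only has real inner products. As usual for Hermitian forms in frame theory,
  \<open>cinner\<close> is linear in its \<^emph>\<open>first\<close> argument. Positive definiteness is inherited from the norm
  through \<open>cinner_self\<close>.\<close>

class complex_inner = real_normed_vector +
  fixes scaleC :: "complex \<Rightarrow> 'a \<Rightarrow> 'a" (infixr "*\<^sub>C" 75)
    and cinner :: "'a \<Rightarrow> 'a \<Rightarrow> complex"
  assumes scaleC_add_right: "c *\<^sub>C (x + y) = c *\<^sub>C x + c *\<^sub>C y"
    and scaleC_add_left: "(c + d) *\<^sub>C x = c *\<^sub>C x + d *\<^sub>C x"
    and scaleC_scaleC: "c *\<^sub>C (d *\<^sub>C x) = (c * d) *\<^sub>C x"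
    and scaleC_of_real: "complex_of_real r *\<^sub>C x = r *\<^sub>R x"
    and cinner_commute: "cinner x y = cnj (cinner y x)"
    and cinner_add_left: "cinner (x + y) z = cinner x z + cinner y z"
    and cinner_scaleC_left: "cinner (c *\<^sub>C x) y = c * cinner x y"
    and cinner_self: "cinner x x = complex_of_real ((norm x)\<^sup>2)"

class complex_hilbert_space = complex_inner + banach

instantiation complex :: complex_hilbert_space
begin

definition scaleC_complex :: "complex \<Rightarrow> complex \<Rightarrow> complex"
  where "scaleC_complex c x = c * x"

definition cinner_complex :: "complex \<Rightarrow> complex \<Rightarrow> complex"
  where "cinner_complex x y = x * cnj y"

instance
  by standard
    (simp_all add: scaleC_complex_def cinner_complex_def algebra_simps scaleR_conv_of_real
      complex_norm_square[symmetric] flip: of_real_power)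

end

definition bounded_clinear :: "('h::complex_inner \<Rightarrow> 'h) \<Rightarrow> bool"
  where "bounded_clinear F \<longleftrightarrow> bounded_linear F \<and> (\<forall>c x. F (c *\<^sub>C x) = c *\<^sub>C F x)"

definition invertible_operator :: "('h::complex_inner \<Rightarrow> 'h) \<Rightarrow> bool"
  where "invertible_operator F \<longleftrightarrow> bounded_clinear F \<and> bij F"

text \<open>Convergence of an operator series in the operator norm. Boundedness is required explicitly
  because \<open>onorm\<close> is only meaningful for bounded operators.\<close>

definition operator_sums :: "(nat \<Rightarrow> 'h::complex_inner \<Rightarrow> 'h) \<Rightarrow> ('h \<Rightarrow> 'h) \<Rightarrow> bool"
  where "operator_sums T S \<longleftrightarrow>
    (\<forall>k. bounded_clinear (T k)) \<and> bounded_clinear S \<and>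
    (\<lambda>n. onorm (\<lambda>h. S h - (\<Sum>k<n. T k h))) \<longlonglongrightarrow> 0"

section \<open>Frames and multipliers\<close>

text \<open>All series over the index set are unordered sums (\<open>summable_on\<close>, \<open>infsum\<close>), since
  a countable index set carries no preferred enumeration.\<close>

definition frame_with_bounds ::
    "'i set \<Rightarrow> ('i \<Rightarrow> 'h::complex_inner) \<Rightarrow> real \<Rightarrow> real \<Rightarrow> bool"
  where "frame_with_bounds I \<Phi> A B \<longleftrightarrow> 0 < A \<and> 0 < B \<and>
    (\<forall>f. (\<lambda>n. (cmod (cinner f (\<Phi> n)))\<^sup>2) summable_on I \<and>
         A * (norm f)\<^sup>2 \<le> (\<Sum>\<^sub>\<infinity>n\<in>I. (cmod (cinner f (\<Phi> n)))\<^sup>2) \<and>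
         (\<Sum>\<^sub>\<infinity>n\<in>I. (cmod (cinner f (\<Phi> n)))\<^sup>2) \<le> B * (norm f)\<^sup>2)"

definition is_frame :: "'i set \<Rightarrow> ('i \<Rightarrow> 'h::complex_inner) \<Rightarrow> bool"
  where "is_frame I \<Phi> \<longleftrightarrow> (\<exists>A B. frame_with_bounds I \<Phi> A B)"

definition frame_with_upper_bound ::
    "'i set \<Rightarrow> ('i \<Rightarrow> 'h::complex_inner) \<Rightarrow> real \<Rightarrow> bool"
  where "frame_with_upper_bound I \<Phi> B \<longleftrightarrow> (\<exists>A. frame_with_bounds I \<Phi> A B)"

text \<open>In a Hilbert space, the series below converges for every \<open>f\<close> because both sequences are
  frames, so the default value of \<open>infsum\<close> for divergent sums plays no role.\<close>

definition approx_dual_frame ::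
    "real \<Rightarrow> 'i set \<Rightarrow> ('i \<Rightarrow> 'h::complex_inner) \<Rightarrow> ('i \<Rightarrow> 'h) \<Rightarrow> bool"
  where "approx_dual_frame \<epsilon> I \<Phi> \<Psi> \<longleftrightarrow> is_frame I \<Phi> \<and> is_frame I \<Psi> \<and>
    (\<forall>f. norm ((\<Sum>\<^sub>\<infinity>n\<in>I. cinner f (\<Phi> n) *\<^sub>C \<Psi> n) - f) \<le> \<epsilon> * norm f)"

text \<open>A multiplier is a partially defined operator, given by its domain and its values there.\<close>

definition multiplier_domain ::
    "'i set \<Rightarrow> ('i \<Rightarrow> complex) \<Rightarrow> ('i \<Rightarrow> 'h::complex_inner) \<Rightarrow> ('i \<Rightarrow> 'h) \<Rightarrow> 'h set"
  where "multiplier_domain I m \<Phi> \<Psi> =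
    {f. (\<lambda>n. (m n * cinner f (\<Psi> n)) *\<^sub>C \<Phi> n) summable_on I}"

definition multiplier ::
    "'i set \<Rightarrow> ('i \<Rightarrow> complex) \<Rightarrow> ('i \<Rightarrow> 'h::complex_inner) \<Rightarrow> ('i \<Rightarrow> 'h) \<Rightarrow> 'h \<Rightarrow> 'h"
  where "multiplier I m \<Phi> \<Psi> f = (\<Sum>\<^sub>\<infinity>n\<in>I. (m n * cinner f (\<Psi> n)) *\<^sub>C \<Phi> n)"

text \<open>The supremum is taken in \<open>[0, \<infinity>]\<close>, so that it is \<open>\<infinity>\<close> for unbounded \<open>m\<close>
  and \<open>0\<close> for an empty index set.\<close>

definition symbol_deviation :: "'i set \<Rightarrow> ('i \<Rightarrow> complex) \<Rightarrow> ennreal"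
  where "symbol_deviation I m = (SUP n\<in>I. ennreal (cmod (m n - 1)))"

end

theory Submission
  imports Defs
begin

text \<open>Writing \<open>M f - f = \<Sum>(m\<^sub>n - 1)\<langle>f, q\<^sub>n\<rangle>p\<^sub>n + (S f - f)\<close> with \<open>S f = \<Sum>\<langle>f, q\<^sub>n\<rangle>p\<^sub>n\<close>, the
  Bessel bounds control the first term by \<open>\<lambda>\<surd>(B\<^sub>\<Phi> B\<^sub>\<Psi>)\<close> and approximate duality controls the
  second one by \<open>\<epsilon>\<close>; when the roles of the frames are exchanged, \<open>S\<close> becomes its adjoint, so the
  same bound applies. Hence \<open>Id - M\<close> is a strict contraction, and the claims are those of the
  Neumann series.\<close>

section \<open>Complex inner product spaces\<close>

lemma cinner_zero_left [simp]: "cinner 0 y = 0"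
  using cinner_add_left[of 0 0 y] by simp

lemma cinner_diff_left: "cinner (x - y) z = cinner x z - cinner y z"
  using cinner_add_left[of "x - y" y z] by simp

lemma cinner_diff_right: "cinner z (x - y) = cinner z x - cinner z y"
  by (metis cinner_commute cinner_diff_left complex_cnj_diff)

lemma cinner_scaleC_right: "cinner x (c *\<^sub>C y) = cnj c * cinner x y"
  by (metis cinner_commute cinner_scaleC_left complex_cnj_mult)

lemma cinner_sum_left: "cinner (\<Sum>i\<in>A. f i) y = (\<Sum>i\<in>A. cinner (f i) y)"
  by (induction A rule: infinite_finite_induct) (simp_all add: cinner_add_left)

lemma scaleR_conv_scaleC: "r *\<^sub>R x = complex_of_real r *\<^sub>C x"
  by (simp add: scaleC_of_real)

lemma cinner_scaleR_left: "cinner (r *\<^sub>R x) y = r *\<^sub>R cinner x y"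
  using cinner_scaleC_left[of "complex_of_real r" x y] by (simp add: scaleC_of_real scaleR_conv_of_real)

lemma norm_scaleC: "norm (c *\<^sub>C x) = cmod c * norm x"
proof -
  have "cinner (c *\<^sub>C x) (c *\<^sub>C x) = (c * cnj c) * cinner x x"
    by (simp add: cinner_scaleC_left cinner_scaleC_right)
  then have "complex_of_real ((norm (c *\<^sub>C x))\<^sup>2) = complex_of_real ((cmod c * norm x)\<^sup>2)"
    by (simp only: cinner_self power_mult_distrib of_real_mult complex_norm_square)
  then have "(norm (c *\<^sub>C x))\<^sup>2 = (cmod c * norm x)\<^sup>2"
    using of_real_eq_iff by blast
  then show ?thesis
    by simp
qed

text \<open>Cauchy-Schwarz, from expanding the squared norm of
  \<open>r *\<^sub>C x - c *\<^sub>C y\<close> with \<open>r = (norm y)\<^sup>2\<close> and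
  \<open>c = cinner x y\<close>. Scaling \<open>x\<close> by \<open>r\<close> avoids dividing by the
  norm of \<open>y\<close>.\<close>

lemma cinner_norm_le: "cmod (cinner x y) \<le> norm x * norm y"
proof (cases "y = 0")
  case True
  then show ?thesis
    by (subst cinner_commute) simp
next
  case False
  define c r where "c = cinner x y" and "r = (norm y)\<^sup>2"
  have "complex_of_real ((norm (complex_of_real r *\<^sub>C x - c *\<^sub>C y))\<^sup>2)
      = cinner (complex_of_real r *\<^sub>C x - c *\<^sub>C y) (complex_of_real r *\<^sub>C x - c *\<^sub>C y)"
    by (simp only: cinner_self)
  also have "\<dots> = complex_of_real r * (complex_of_real r * cinner x x - c * cnj c)"
  proof -
    have "cinner y x = cnj c" "cinner y y = complex_of_real r"
      by (simp_all only: c_def r_def cinner_self flip: cinner_commute)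
    then show ?thesis
      by (simp add: cinner_diff_left cinner_diff_right cinner_scaleC_left cinner_scaleC_right
          algebra_simps flip: c_def)
  qed
  also have "\<dots> = complex_of_real (r * (r * (norm x)\<^sup>2 - (cmod c)\<^sup>2))"
    by (simp only: cinner_self of_real_mult of_real_diff complex_norm_square)
  finally have "(norm (complex_of_real r *\<^sub>C x - c *\<^sub>C y))\<^sup>2 = r * (r * (norm x)\<^sup>2 - (cmod c)\<^sup>2)"
    using of_real_eq_iff by blast
  then have "0 \<le> r * (r * (norm x)\<^sup>2 - (cmod c)\<^sup>2)"
    by (metis zero_le_power2)
  then have "(cmod c)\<^sup>2 \<le> (norm x * norm y)\<^sup>2"
    using False by (simp add: r_def zero_le_mult_iff power_mult_distrib mult.commute)
  then show ?thesis
    unfolding c_def by (rule power2_le_imp_le) simp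
qed

section \<open>Continuity of the inner product and of scalar multiplication\<close>

lemma bounded_linear_cinner_left: "bounded_linear (\<lambda>x. cinner x y)"
  by (rule bounded_linear_intro[where K = "norm y"])
    (auto simp: cinner_add_left cinner_scaleR_left cinner_norm_le)

lemma bounded_linear_scaleC: "bounded_linear (\<lambda>x. c *\<^sub>C x)"
  by (rule bounded_linear_intro[where K = "cmod c"])
    (auto simp: scaleC_add_right norm_scaleC scaleR_conv_scaleC scaleC_scaleC mult.commute)

lemma scaleC_diff_right: "c *\<^sub>C (x - y) = c *\<^sub>C x - c *\<^sub>C y"
  using linear_diff[OF bounded_linear.linear[OF bounded_linear_scaleC]] .

section \<open>Bessel sequences\<close>

text \<open>Cauchy criterion for unordered sums: once a finite set nearly exhausts the sum of
  \<open>g\<close>, every finite sum of \<open>f\<close> outside it is small. The squared norm fits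
  Bessel bounds, where the terms need not be absolutely summable.\<close>

lemma
  fixes f :: "'i \<Rightarrow> 'h::banach" and g :: "'i \<Rightarrow> real"
  assumes g: "g summable_on A" "\<And>n. n \<in> A \<Longrightarrow> 0 \<le> g n" and C: "0 \<le> C"
    and le: "\<And>F. finite F \<Longrightarrow> F \<subseteq> A \<Longrightarrow> (norm (sum f F))\<^sup>2 \<le> C * sum g F"
  shows summable_on_norm_square_le: "f summable_on A"
    and norm_square_infsum_le: "(norm (infsum f A))\<^sup>2 \<le> C * infsum g A"
proof -
  have "\<exists>P. eventually P (finite_subsets_at_top A) \<and>
              (\<forall>F F'. P F \<and> P F' \<longrightarrow> dist (sum f F) (sum f F') < e)" if "e > 0" for e
  proof -
    \<comment> \<open>The summand 1 in the denominator makes \<open>C * d < (e / 2)\<^sup>2\<close>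
      strict and covers \<open>C = 0\<close>.\<close>
    define d where "d = (e / 2)\<^sup>2 / (C + 1)"
    have d: "d > 0" "C * d < (e / 2)\<^sup>2"
      using that C by (auto simp: d_def field_simps)
    obtain F0 where F0: "finite F0" "F0 \<subseteq> A" "dist (sum g F0) (infsum g A) \<le> d"
      using infsum_finite_approximation[OF g(1) d(1)] by blast
    have close: "dist (sum f F) (sum f F0) < e / 2" if F: "finite F" "F0 \<subseteq> F" "F \<subseteq> A" for F
    proof -
      have "(dist (sum f F) (sum f F0))\<^sup>2 = (norm (sum f (F - F0)))\<^sup>2"
        using F by (simp add: dist_norm sum_diff)
      also have "\<dots> \<le> C * sum g (F - F0)"
        using F by (intro le) auto
      also have "sum g (F - F0) = sum g F - sum g F0"
        using F by (simp add: sum_diff)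
      also have "sum g F \<le> infsum g A"
        using F g by (intro finite_sum_le_infsum) auto
      then have "C * (sum g F - sum g F0) \<le> C * d"
        using F0(3) C by (intro mult_left_mono) (auto simp: dist_real_def)
      also note d(2)
      finally show ?thesis
        by (rule power2_less_imp_less) (use \<open>e > 0\<close> in simp)
    qed
    have "eventually (\<lambda>F. finite F \<and> F0 \<subseteq> F \<and> F \<subseteq> A) (finite_subsets_at_top A)"
      using F0 by (auto simp: eventually_finite_subsets_at_top)
    moreover have "dist (sum f F) (sum f F') < e"
      if "finite F \<and> F0 \<subseteq> F \<and> F \<subseteq> A" "finite F' \<and> F0 \<subseteq> F' \<and> F' \<subseteq> A" for F F'
      using close[of F] close[of F'] that by (meson dist_triangle_half_l)
    ultimately show ?thesis
      by (intro exI[of _ "\<lambda>F. finite F \<and> F0 \<subseteq> F \<and> F \<subseteq> A"]) blast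
  qed
  then have "cauchy_filter (filtermap (sum f) (finite_subsets_at_top A))"
    by (simp add: cauchy_filter_metric_filtermap)
  then obtain L where "(sum f \<longlongrightarrow> L) (finite_subsets_at_top A)"
    using complete_uniform[where S = "UNIV :: 'h set"] complete_UNIV
    by (force simp add: filterlim_def)
  then show f: "f summable_on A"
    using summable_on_def has_sum_def by blast
  have "((\<lambda>F. (norm (sum f F))\<^sup>2) \<longlongrightarrow> (norm (infsum f A))\<^sup>2) (finite_subsets_at_top A)"
    by (intro tendsto_intros infsum_tendsto f)
  moreover have "((\<lambda>F. C * sum g F) \<longlongrightarrow> C * infsum g A) (finite_subsets_at_top A)"
    by (intro tendsto_intros infsum_tendsto g)
  moreover have "\<forall>\<^sub>F F in finite_subsets_at_top A. (norm (sum f F))\<^sup>2 \<le> C * sum g F"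
    by (intro eventually_finite_subsets_at_top_weakI le)
  ultimately show "(norm (infsum f A))\<^sup>2 \<le> C * infsum g A"
    using tendsto_le[OF finite_subsets_at_top_neq_bot] by blast
qed

text \<open>The upper half of the frame condition, which governs convergence and norm estimates of
  multipliers.\<close>

definition bessel :: "'i set \<Rightarrow> ('i \<Rightarrow> 'h::complex_inner) \<Rightarrow> real \<Rightarrow> bool"
  where "bessel I P B \<longleftrightarrow> 0 \<le> B \<and>
    (\<forall>f. (\<lambda>n. (cmod (cinner f (P n)))\<^sup>2) summable_on I \<and>
         (\<Sum>\<^sub>\<infinity>n\<in>I. (cmod (cinner f (P n)))\<^sup>2) \<le> B * (norm f)\<^sup>2)"

lemma bessel_finite_sum_le:
  assumes "bessel I P B" "finite F" "F \<subseteq> I"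
  shows "(\<Sum>n\<in>F. (cmod (cinner f (P n)))\<^sup>2) \<le> B * (norm f)\<^sup>2"
proof -
  have "(\<Sum>n\<in>F. (cmod (cinner f (P n)))\<^sup>2) \<le> (\<Sum>\<^sub>\<infinity>n\<in>I. (cmod (cinner f (P n)))\<^sup>2)"
    using assms unfolding bessel_def by (intro finite_sum_le_infsum) auto
  then show ?thesis
    using assms unfolding bessel_def by (meson order_trans)
qed

text \<open>Synthesis is adjoint to analysis and so obeys the same bound. Concretely, the sum
  \<open>g\<close> is paired with itself, Cauchy-Schwarz is applied to the coefficients, and one
  factor \<open>norm g\<close> is cancelled.\<close>

lemma bessel_synthesis_le:
  assumes P: "bessel I P B" and F: "finite F" "F \<subseteq> I"
  shows "(norm (\<Sum>n\<in>F. d n *\<^sub>C P n))\<^sup>2 \<le> B * (\<Sum>n\<in>F. (cmod (d n))\<^sup>2)"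
proof -
  define g where "g = (\<Sum>n\<in>F. d n *\<^sub>C P n)"
  have B: "0 \<le> B"
    using P by (simp add: bessel_def)
  have "complex_of_real ((norm g)\<^sup>2) = (\<Sum>n\<in>F. d n * cinner (P n) g)"
    unfolding cinner_self[symmetric] by (subst g_def) (simp add: cinner_sum_left cinner_scaleC_left)
  then have "(norm g)\<^sup>2 = cmod (\<Sum>n\<in>F. d n * cinner (P n) g)"
    by (metis abs_of_nonneg norm_of_real zero_le_power2)
  \<comment> \<open>The absolute values of norms match the form of
    \<open>L2_set_mult_ineq\<close>.\<close>
  also have "\<dots> \<le> (\<Sum>n\<in>F. \<bar>cmod (d n)\<bar> * \<bar>cmod (cinner g (P n))\<bar>)"
    by (rule sum_norm_le) (metis abs_norm_cancel cinner_commute complex_mod_cnj norm_mult order_refl)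
  also have "\<dots> \<le> L2_set (\<lambda>n. cmod (d n)) F * L2_set (\<lambda>n. cmod (cinner g (P n))) F"
    by (rule L2_set_mult_ineq)
  also have "\<dots> \<le> sqrt (\<Sum>n\<in>F. (cmod (d n))\<^sup>2) * sqrt (B * (norm g)\<^sup>2)"
    unfolding L2_set_def
    by (intro mult_left_mono real_sqrt_le_mono bessel_finite_sum_le[OF P F]) (auto intro: sum_nonneg)
  finally have "norm g * norm g \<le> sqrt (B * (\<Sum>n\<in>F. (cmod (d n))\<^sup>2)) * norm g"
    by (simp add: real_sqrt_mult power2_eq_square mult_ac)
  then have "norm g \<le> sqrt (B * (\<Sum>n\<in>F. (cmod (d n))\<^sup>2))"
    using B by (cases "g = 0") (auto intro!: mult_nonneg_nonneg sum_nonneg)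
  then have "(norm g)\<^sup>2 \<le> (sqrt (B * (\<Sum>n\<in>F. (cmod (d n))\<^sup>2)))\<^sup>2"
    by (intro power_mono) auto
  then show ?thesis
    using B by (simp add: g_def sum_nonneg)
qed

text \<open>Analysis by \<open>Q\<close> yields square-summable coefficients, the symbol scales them
  by at most \<open>L\<close>, and synthesis by \<open>P\<close> is bounded on them.\<close>

lemma
  fixes P Q :: "'i \<Rightarrow> 'h::complex_hilbert_space"
  assumes P: "bessel I P B" and Q: "bessel I Q B'"
    and c: "\<And>n. n \<in> I \<Longrightarrow> cmod (c n) \<le> L" and L: "0 \<le> L"
  shows bessel_multiplier_summable: "(\<lambda>n. (c n * cinner f (Q n)) *\<^sub>C P n) summable_on I"
    and bessel_multiplier_norm_le: "norm (multiplier I c P Q f) \<le> L * sqrt (B * B') * norm f"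
proof -
  define g where "g n = (cmod (cinner f (Q n)))\<^sup>2" for n
  have B: "0 \<le> B" "0 \<le> B'"
    using P Q by (auto simp: bessel_def)
  have g: "g summable_on I" "\<And>n. n \<in> I \<Longrightarrow> 0 \<le> g n" "infsum g I \<le> B' * (norm f)\<^sup>2"
    using Q unfolding bessel_def g_def by auto
  \<comment> \<open>The bound \<open>B'\<close> enters only after summation over all of
    \<open>I\<close>; a finite sum costs \<open>B\<close> for synthesis and \<open>L\<^sup>2\<close>
    for the symbol.\<close>
  have le: "(norm (\<Sum>n\<in>F. (c n * cinner f (Q n)) *\<^sub>C P n))\<^sup>2 \<le> (B * L\<^sup>2) * sum g F"
    if F: "finite F" "F \<subseteq> I" for F
  proof -
    have "(norm (\<Sum>n\<in>F. (c n * cinner f (Q n)) *\<^sub>C P n))\<^sup>2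
        \<le> B * (\<Sum>n\<in>F. (cmod (c n * cinner f (Q n)))\<^sup>2)"
      by (rule bessel_synthesis_le[OF P F])
    also have "\<dots> \<le> B * (\<Sum>n\<in>F. L\<^sup>2 * g n)"
      using B F c by (intro mult_left_mono sum_mono)
        (auto simp: g_def norm_mult power_mult_distrib intro!: mult_right_mono power_mono)
    finally show ?thesis
      by (simp add: sum_distrib_left mult.assoc)
  qed
  have C: "0 \<le> B * L\<^sup>2"
    using B by simp
  show "(\<lambda>n. (c n * cinner f (Q n)) *\<^sub>C P n) summable_on I"
    by (rule summable_on_norm_square_le[OF g(1,2) C le])
  have "(norm (multiplier I c P Q f))\<^sup>2 \<le> B * L\<^sup>2 * infsum g I"
    unfolding multiplier_def by (rule norm_square_infsum_le[OF g(1,2) C le])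
  also have "\<dots> \<le> B * L\<^sup>2 * (B' * (norm f)\<^sup>2)"
    by (intro mult_left_mono g C)
  also have "\<dots> = (L * sqrt (B * B') * norm f)\<^sup>2"
    using B by (simp add: power_mult_distrib)
  finally show "norm (multiplier I c P Q f) \<le> L * sqrt (B * B') * norm f"
    by (rule power2_le_imp_le) (use B L in simp)
qed

text \<open>Convergence at every vector is what lets \<open>infsum\<close> respect sums and scalar
  multiples.\<close>

lemma bounded_clinear_multiplier:
  fixes P Q :: "'i \<Rightarrow> 'h::complex_hilbert_space"
  assumes P: "bessel I P B" and Q: "bessel I Q B'"
    and c: "\<And>n. n \<in> I \<Longrightarrow> cmod (c n) \<le> L" and L: "0 \<le> L"
  shows "bounded_clinear (multiplier I c P Q)"
proof -
  note s = bessel_multiplier_summable[OF P Q c L]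
  have add: "multiplier I c P Q (x + y) = multiplier I c P Q x + multiplier I c P Q y" for x y
    using infsum_add[OF s[where f = x] s[where f = y]]
    by (simp add: multiplier_def cinner_add_left scaleC_add_left distrib_left)
  have scale: "multiplier I c P Q (a *\<^sub>C x) = a *\<^sub>C multiplier I c P Q x" for a x
  proof -
    have "((\<lambda>n. a *\<^sub>C ((c n * cinner x (Q n)) *\<^sub>C P n)) has_sum a *\<^sub>C multiplier I c P Q x) I"
      unfolding multiplier_def by (intro has_sum_bounded_linear[OF bounded_linear_scaleC] has_sum_infsum s)
    then have "((\<lambda>n. (c n * cinner (a *\<^sub>C x) (Q n)) *\<^sub>C P n) has_sum a *\<^sub>C multiplier I c P Q x) I"
      by (simp add: scaleC_scaleC cinner_scaleC_left mult_ac)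
    then show ?thesis
      by (simp add: multiplier_def infsumI)
  qed
  show ?thesis
    unfolding bounded_clinear_def
    using bessel_multiplier_norm_le[OF P Q c L]
    by (auto intro!: bounded_linear_intro[where K = "L * sqrt (B * B')"]
        simp: add scale scaleR_conv_scaleC mult.commute)
qed

text \<open>Both sides expand to the series of
  \<open>cinner f (Q n) * cinner (P n) g\<close>.\<close>

lemma multiplier_adjoint:
  fixes P Q :: "'i \<Rightarrow> 'h::complex_hilbert_space"
  assumes P: "bessel I P B" and Q: "bessel I Q B'"
  shows "cinner (multiplier I (\<lambda>_. 1) P Q f) g = cinner f (multiplier I (\<lambda>_. 1) Q P g)"
proof -
  \<comment> \<open>Stated for an arbitrary pair because it is applied in both orders.\<close>
  have 1: "cinner (multiplier I (\<lambda>_. 1) X Y u) v = (\<Sum>\<^sub>\<infinity>n\<in>I. cinner u (Y n) * cinner (X n) v)"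
    if X: "bessel I X C" and Y: "bessel I Y C'" for X Y :: "'i \<Rightarrow> 'h" and C C' u v
  proof -
    have "(\<lambda>n. (1 * cinner u (Y n)) *\<^sub>C X n) summable_on I"
      by (rule bessel_multiplier_summable[OF X Y, of _ 1]) auto
    then have "((\<lambda>n. cinner ((1 * cinner u (Y n)) *\<^sub>C X n) v) has_sum
        cinner (multiplier I (\<lambda>_. 1) X Y u) v) I"
      unfolding multiplier_def by (intro has_sum_bounded_linear[OF bounded_linear_cinner_left] has_sum_infsum)
    then show ?thesis
      by (simp add: cinner_scaleC_left infsumI)
  qed
  have "cinner f (multiplier I (\<lambda>_. 1) Q P g) = cnj (\<Sum>\<^sub>\<infinity>n\<in>I. cinner g (P n) * cinner (Q n) f)"
    by (subst cinner_commute) (simp add: 1[OF Q P])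
  also have "\<dots> = (\<Sum>\<^sub>\<infinity>n\<in>I. cinner f (Q n) * cinner (P n) g)"
    by (subst infsum_cnj[symmetric], rule infsum_cong)
      (metis cinner_commute complex_cnj_mult mult.commute)
  finally show ?thesis
    by (simp add: 1[OF P Q])
qed

text \<open>An operator and its adjoint have the same norm. Pairing \<open>u\<close> with itself
  moves the difference from the identity onto the other multiplier, evaluated at \<open>u\<close>,
  where the hypothesis applies.\<close>

lemma multiplier_swap_diff_le:
  fixes P Q :: "'i \<Rightarrow> 'h::complex_hilbert_space"
  assumes P: "bessel I P B" and Q: "bessel I Q B'"
    and le: "\<And>f. norm (multiplier I (\<lambda>_. 1) P Q f - f) \<le> \<epsilon> * norm f"
  shows "norm (multiplier I (\<lambda>_. 1) Q P f - f) \<le> \<epsilon> * norm f"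
proof -
  define u where "u = multiplier I (\<lambda>_. 1) Q P f - f"
  have "cinner u u = cinner f (multiplier I (\<lambda>_. 1) P Q u - u)"
    by (subst (1) u_def) (simp add: cinner_diff_left cinner_diff_right multiplier_adjoint[OF Q P])
  then have "complex_of_real ((norm u)\<^sup>2) = cinner f (multiplier I (\<lambda>_. 1) P Q u - u)"
    by (simp add: cinner_self)
  then have "(norm u)\<^sup>2 = cmod (cinner f (multiplier I (\<lambda>_. 1) P Q u - u))"
    by (metis abs_of_nonneg norm_of_real zero_le_power2)
  also have "\<dots> \<le> norm f * (\<epsilon> * norm u)"
    by (rule order_trans[OF cinner_norm_le mult_left_mono[OF le]]) simp
  finally have "norm u * norm u \<le> (\<epsilon> * norm f) * norm u"
    by (simp add: power2_eq_square mult_ac)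
  \<comment> \<open>Settles the case \<open>u = 0\<close>, in which \<open>norm u\<close> cannot be
    cancelled.\<close>
  moreover have "0 \<le> \<epsilon> * norm f"
    using le[of f] norm_ge_zero order_trans by blast
  ultimately show ?thesis
    unfolding u_def[symmetric] by (cases "u = 0") auto
qed

text \<open>The contraction estimate: the symbol is split as \<open>(m n - 1) + 1\<close>, and the
  two summands contribute the two terms of the factor.\<close>

lemma multiplier_diff_id_le:
  fixes P Q :: "'i \<Rightarrow> 'h::complex_hilbert_space"
  assumes P: "bessel I P B" and Q: "bessel I Q B'"
    and le: "\<And>f. norm (multiplier I (\<lambda>_. 1) P Q f - f) \<le> \<epsilon> * norm f"
    and m: "\<And>n. n \<in> I \<Longrightarrow> cmod (m n - 1) \<le> L" and L: "0 \<le> L"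
  shows "norm (f - multiplier I m P Q f) \<le> (L * sqrt (B * B') + \<epsilon>) * norm f"
proof -
  have s: "(\<lambda>n. ((m n - 1) * cinner f (Q n)) *\<^sub>C P n) summable_on I"
    by (rule bessel_multiplier_summable[OF P Q m L])
  have s1: "(\<lambda>n. (1 * cinner f (Q n)) *\<^sub>C P n) summable_on I"
    by (rule bessel_multiplier_summable[OF P Q, of _ 1]) auto
  have "multiplier I m P Q f = multiplier I (\<lambda>n. m n - 1) P Q f + multiplier I (\<lambda>_. 1) P Q f"
    unfolding multiplier_def infsum_add[OF s s1, symmetric]
    by (simp add: algebra_simps flip: scaleC_add_left)
  then have "norm (f - multiplier I m P Q f) =
      norm (multiplier I (\<lambda>n. m n - 1) P Q f + (multiplier I (\<lambda>_. 1) P Q f - f))"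
    by (simp add: norm_minus_commute algebra_simps)
  also have "\<dots> \<le> L * sqrt (B * B') * norm f + \<epsilon> * norm f"
    by (intro norm_triangle_le add_mono bessel_multiplier_norm_le[OF P Q m L] le)
  finally show ?thesis
    by (simp add: algebra_simps)
qed

section \<open>Neumann series\<close>

text \<open>The frame-free part of the argument; \<open>q\<close> will be
  \<open>lam * sqrt (B\<^sub>\<Phi> * B\<^sub>\<Psi>) + \<epsilon>\<close>.\<close>

locale near_identity =
  fixes M :: "'h::complex_hilbert_space \<Rightarrow> 'h" and q :: real
  assumes bounded_clinear: "bounded_clinear M"
    and q: "0 \<le> q" "q < 1"
    and diff_le: "norm (h - M h) \<le> q * norm h"
begin

sublocale bounded_linear M
  using bounded_clinear by (simp add: bounded_clinear_def)

lemma scaleC: "M (c *\<^sub>C x) = c *\<^sub>C M x"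
  using bounded_clinear by (simp add: bounded_clinear_def)

lemma norm_image_ge: "(1 - q) * norm h \<le> norm (M h)"
  using diff_le[of h] norm_triangle_ineq2[of h "h - M h"] by (simp add: algebra_simps)

lemma norm_image_le: "norm (M h) \<le> (1 + q) * norm h"
  using diff_le[of h] norm_triangle_ineq4[of h "h - M h"] by (simp add: algebra_simps)

text \<open>Injectivity follows from the lower bound on \<open>M\<close>. For surjectivity, a fixed
  point of the contraction sending \<open>x\<close> to \<open>y + (x - M x)\<close> is a solution of
  \<open>M x = y\<close>; Banach's theorem supplies it.\<close>

lemma bij: "bij M"
proof (rule bijI)
  show "inj M"
  proof (rule injI)
    fix x y
    assume "M x = M y"
    then show "x = y"
      using norm_image_ge[of "x - y"] q by (simp add: diff mult_le_0_iff)
  qed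
  show "surj M"
    unfolding surj_def
  proof
    fix y
    have "\<exists>!x. y + (x - M x) = x"
    proof (rule banach_fix_type[OF q], intro allI)
      fix u v
      show "dist (y + (u - M u)) (y + (v - M v)) \<le> q * dist u v"
        using diff_le[of "u - v"] by (simp add: dist_norm diff algebra_simps)
    qed
    then obtain x where "y + (x - M x) = x"
      by blast
    then show "\<exists>x. y = M x"
      by (metis add.commute add_diff_cancel_left' add_diff_eq diff_add_cancel)
  qed
qed

lemma image_inv [simp]: "M (inv M h) = h"
  using bij by (simp add: bij_is_surj surj_f_inv_f)

lemma inv_eqI: "M x = y \<Longrightarrow> inv M y = x"
  using bij by (metis bij_inv_eq_iff)

text \<open>The lower bound on \<open>M\<close>, read at \<open>inv M h\<close>, bounds the inverse
  from above; the upper bound on \<open>M\<close> likewise gives the lower bound below.\<close>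

lemma norm_inv_le: "norm (inv M h) \<le> 1 / (1 - q) * norm h"
  using norm_image_ge[of "inv M h"] q by (simp add: field_simps)

lemma norm_inv_ge: "1 / (1 + q) * norm h \<le> norm (inv M h)"
  using norm_image_le[of "inv M h"] q by (simp add: field_simps)

lemma bounded_clinear_inv: "bounded_clinear (inv M)"
  unfolding bounded_clinear_def
  using norm_inv_le
  by (auto intro!: bounded_linear_intro[where K = "1 / (1 - q)"] inv_eqI
      simp: add scaleC scaleR mult.commute)

section \<open>Powers of \<open>Id - M\<close> and the Neumann remainder\<close>

lemma norm_power_le: "norm (((\<lambda>g. g - M g) ^^ n) h) \<le> q ^ n * norm h"
proof (induction n)
  case (Suc n)
  have "norm (((\<lambda>g. g - M g) ^^ Suc n) h) \<le> q * norm (((\<lambda>g. g - M g) ^^ n) h)"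
    using diff_le by simp
  also have "\<dots> \<le> q * (q ^ n * norm h)"
    by (intro mult_left_mono Suc.IH q)
  finally show ?case
    by (simp add: mult_ac)
qed simp

lemma bounded_clinear_power: "bounded_clinear ((\<lambda>g. g - M g) ^^ n)"
proof -
  have "((\<lambda>g. g - M g) ^^ n) (x + y) = ((\<lambda>g. g - M g) ^^ n) x + ((\<lambda>g. g - M g) ^^ n) y" for x y
    by (induction n) (simp_all add: add)
  moreover have "((\<lambda>g. g - M g) ^^ n) (c *\<^sub>C x) = c *\<^sub>C ((\<lambda>g. g - M g) ^^ n) x" for c x
    by (induction n) (simp_all add: scaleC scaleC_diff_right)
  \<comment> \<open>Real homogeneity is treated separately because \<open>bounded_linear\<close> is
    a notion over the reals.\<close>
  moreover have "((\<lambda>g. g - M g) ^^ n) (r *\<^sub>R x) = r *\<^sub>R ((\<lambda>g. g - M g) ^^ n) x" for r x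
    by (induction n) (simp_all add: scaleR scaleR_diff_right)
  ultimately show ?thesis
    unfolding bounded_clinear_def
    using norm_power_le
    by (auto intro!: bounded_linear_intro[where K = "q ^ n"] simp: mult.commute)
qed

text \<open>An exact geometric-sum identity, which turns the error estimate into a bound on one
  power of \<open>Id - M\<close>.\<close>

lemma neumann_remainder:
  "inv M h - (\<Sum>k<n. ((\<lambda>g. g - M g) ^^ k) h) = ((\<lambda>g. g - M g) ^^ n) (inv M h)"
proof (induction n)
  case (Suc n)
  interpret R: bounded_linear "(\<lambda>g. g - M g) ^^ n"
    using bounded_clinear_power by (simp add: bounded_clinear_def)
  \<comment> \<open>The extra factor is peeled off on the inside, where it meets
    \<open>inv M h\<close> and produces \<open>inv M h - h\<close>.\<close>
  have "((\<lambda>g. g - M g) ^^ Suc n) (inv M h) = ((\<lambda>g. g - M g) ^^ n) (inv M h - h)"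
    by (simp add: funpow_Suc_right del: funpow.simps)
  also have "\<dots> = ((\<lambda>g. g - M g) ^^ n) (inv M h) - ((\<lambda>g. g - M g) ^^ n) h"
    by (rule R.diff)
  finally show ?case
    using Suc.IH by (simp add: diff_diff_eq[symmetric])
qed simp

lemma neumann_error_le:
  "onorm (\<lambda>h. inv M h - (\<Sum>k<n. ((\<lambda>g. g - M g) ^^ k) h)) \<le> q ^ n / (1 - q)"
proof (rule onorm_bound)
  show "norm (inv M h - (\<Sum>k<n. ((\<lambda>g. g - M g) ^^ k) h)) \<le> q ^ n / (1 - q) * norm h" for h
  proof -
    have "norm (((\<lambda>g. g - M g) ^^ n) (inv M h)) \<le> q ^ n * norm (inv M h)"
      by (rule norm_power_le)
    also have "\<dots> \<le> q ^ n * (1 / (1 - q) * norm h)"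
      by (intro mult_left_mono norm_inv_le) (simp add: q)
    finally show ?thesis
      by (simp add: neumann_remainder)
  qed
qed (use q in simp)

lemma neumann_sums: "operator_sums (\<lambda>k. (\<lambda>g. g - M g) ^^ k) (inv M)"
proof -
  let ?e = "\<lambda>n. onorm (\<lambda>h. inv M h - (\<Sum>k<n. ((\<lambda>g. g - M g) ^^ k) h))"
  have "bounded_linear (\<lambda>h. inv M h - (\<Sum>k<n. ((\<lambda>g. g - M g) ^^ k) h))" for n
    using bounded_clinear_inv bounded_clinear_power
    by (intro bounded_linear_sub bounded_linear_sum) (auto simp: bounded_clinear_def)
  \<comment> \<open>Nonnegativity of \<open>onorm\<close> rests on boundedness; it identifies
    \<open>norm (?e n)\<close> with \<open>?e n\<close> for the comparison with a geometric
    sequence.\<close>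
  then have "0 \<le> ?e n" for n
    by (rule onorm_pos_le)
  then have "\<forall>n. norm (?e n) \<le> q ^ n / (1 - q)"
    using neumann_error_le by simp
  moreover have "(\<lambda>n. q ^ n / (1 - q)) \<longlonglongrightarrow> 0"
    using q by (intro tendsto_divide_zero LIMSEQ_realpow_zero)
  ultimately have "?e \<longlonglongrightarrow> 0"
    by (rule Lim_null_comparison[OF always_eventually])
  then show ?thesis
    by (simp add: operator_sums_def bounded_clinear_inv bounded_clinear_power)
qed

end

section \<open>Invertibility of multipliers\<close>

lemma frame_with_upper_bound_bessel:
  "frame_with_upper_bound I P B \<Longrightarrow> 0 < B \<and> bessel I P B"
  unfolding frame_with_upper_bound_def frame_with_bounds_def bessel_def by auto

text \<open>Finiteness matters: \<open>enn2real\<close> sends infinity to 0, which would make the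
  bound false for an unbounded symbol.\<close>

lemma cmod_le_symbol_deviation:
  assumes "symbol_deviation I m < \<infinity>" "n \<in> I"
  shows "cmod (m n - 1) \<le> enn2real (symbol_deviation I m)"
proof -
  have "ennreal (cmod (m n - 1)) \<le> symbol_deviation I m"
    unfolding symbol_deviation_def using assms(2) by (rule SUP_upper)
  then show ?thesis
    using assms(1) by (metis enn2real_ennreal enn2real_mono infinity_ennreal_def norm_ge_zero)
qed

theorem proposition3p11:
  fixes I :: "'i set"
    and \<Phi> \<Psi> P Q :: "'i \<Rightarrow> 'h::complex_hilbert_space"
    and m :: "'i \<Rightarrow> complex"
    and \<epsilon> B\<^sub>\<Phi> B\<^sub>\<Psi> lam :: real
    and M :: "'h \<Rightarrow> 'h"
  assumes "separable_space (euclidean :: 'h topology)"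
    and "countable I"
    and "0 \<le> \<epsilon>" and "\<epsilon> < 1"
    and "frame_with_upper_bound I \<Phi> B\<^sub>\<Phi>"
    and "frame_with_upper_bound I \<Psi> B\<^sub>\<Psi>"
    and "approx_dual_frame \<epsilon> I \<Phi> \<Psi>"
    and "symbol_deviation I m < ennreal ((1 - \<epsilon>) / sqrt (B\<^sub>\<Phi> * B\<^sub>\<Psi>))"
    and "lam = enn2real (symbol_deviation I m)"
    and "(P, Q) \<in> {(\<Phi>, \<Psi>), (\<Psi>, \<Phi>)}"
    and "M = multiplier I m P Q"
  shows "multiplier_domain I m P Q = UNIV \<and> invertible_operator M \<and>
    (\<forall>h. 1 / (1 + lam * sqrt (B\<^sub>\<Phi> * B\<^sub>\<Psi>) + \<epsilon>) * norm h \<le> norm (inv M h) \<and>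
         norm (inv M h) \<le> 1 / (1 - lam * sqrt (B\<^sub>\<Phi> * B\<^sub>\<Psi>) - \<epsilon>) * norm h) \<and>
    operator_sums (\<lambda>k. (\<lambda>h. h - M h) ^^ k) (inv M) \<and>
    (\<forall>n::nat. onorm (\<lambda>h. inv M h - (\<Sum>k\<le>n. ((\<lambda>g. g - M g) ^^ k) h))
       \<le> (lam * sqrt (B\<^sub>\<Phi> * B\<^sub>\<Psi>) + \<epsilon>) ^ (n + 1) / (1 - lam * sqrt (B\<^sub>\<Phi> * B\<^sub>\<Psi>) - \<epsilon>))"
proof -
  define s where "s = sqrt (B\<^sub>\<Phi> * B\<^sub>\<Psi>)"
  define q where "q = lam * s + \<epsilon>"
  have \<Phi>: "0 < B\<^sub>\<Phi>" "bessel I \<Phi> B\<^sub>\<Phi>" and \<Psi>: "0 < B\<^sub>\<Psi>" "bessel I \<Psi> B\<^sub>\<Psi>"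
    using frame_with_upper_bound_bessel assms(5,6) by blast+
  then have s: "0 < s"
    by (simp add: s_def)
  have fin: "symbol_deviation I m < \<infinity>"
    using assms(8) by (metis ennreal_less_top infinity_ennreal_def order_less_trans)
  have lam: "0 \<le> lam" "lam < (1 - \<epsilon>) / s"
    using assms(4,8,9) fin s enn2real_less_iff unfolding s_def[symmetric] by auto
  have m: "cmod (m n - 1) \<le> lam" if "n \<in> I" for n
    using cmod_le_symbol_deviation[OF fin that] assms(9) by simp
  \<comment> \<open>This bound on the symbol itself gives convergence everywhere and boundedness of
    \<open>M\<close>; the contraction estimate uses the deviation from 1.\<close>
  have m1: "cmod (m n) \<le> 1 + lam" if "n \<in> I" for n
    using m[OF that] norm_triangle_sub[of "m n" 1] by simp
  \<comment> \<open>The smallness of \<open>lam\<close> enters here: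
    \<open>lam * s < 1 - \<epsilon>\<close> is exactly \<open>q < 1\<close>.\<close>
  have q: "0 \<le> q" "q < 1"
    using lam s assms(3) by (simp_all add: q_def field_simps)
  \<comment> \<open>Approximate duality analyses with \<open>\<Phi>\<close> and synthesises with
    \<open>\<Psi>\<close>, so it concerns the order \<open>\<Psi>\<close>, \<open>\<Phi>\<close>;
    the other order comes from the adjoint.\<close>
  have dual: "norm (multiplier I (\<lambda>_. 1) \<Psi> \<Phi> f - f) \<le> \<epsilon> * norm f" for f
    using assms(7) by (simp add: approx_dual_frame_def multiplier_def)
  \<comment> \<open>Both choices of \<open>M\<close> are merged: exchanging the frames exchanges the
    bounds and leaves \<open>s\<close> unchanged.\<close>
  obtain B B' where P: "bessel I P B" and Q: "bessel I Q B'" and BB: "sqrt (B * B') = s"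
    and PQ: "\<And>f. norm (multiplier I (\<lambda>_. 1) P Q f - f) \<le> \<epsilon> * norm f"
  proof (cases "P = \<Psi> \<and> Q = \<Phi>")
    case True
    then show ?thesis
      using that[of B\<^sub>\<Psi> B\<^sub>\<Phi>] \<Phi> \<Psi> dual by (simp add: s_def mult.commute)
  next
    case False
    then have "P = \<Phi> \<and> Q = \<Psi>"
      using assms(10) by auto
    then show ?thesis
      using that[of B\<^sub>\<Phi> B\<^sub>\<Psi>] \<Phi> \<Psi> multiplier_swap_diff_le[OF \<Psi>(2) \<Phi>(2) dual] by (simp add: s_def)
  qed
  have L: "0 \<le> 1 + lam"
    using lam by simp
  have dom: "multiplier_domain I m P Q = UNIV"
    using bessel_multiplier_summable[OF P Q m1 L] by (auto simp: multiplier_domain_def)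
  interpret near_identity M q
  proof
    show "bounded_clinear M"
      unfolding assms(11) by (rule bounded_clinear_multiplier[OF P Q m1 L])
    show "norm (h - M h) \<le> q * norm h" for h
      using multiplier_diff_id_le[OF P Q PQ m lam(1)] by (simp add: assms(11) q_def BB)
  qed (fact q)+
  have [simp]: "1 + lam * s + \<epsilon> = 1 + q" "1 - lam * s - \<epsilon> = 1 - q" "lam * s + \<epsilon> = q"
    by (simp_all add: q_def)
  \<comment> \<open>The sum over \<open>k \<le> n\<close> has \<open>n + 1\<close> terms, so the
    error estimate is taken at \<open>Suc n\<close>.\<close>
  show ?thesis
    unfolding s_def[symmetric] invertible_operator_def
    using dom bounded_clinear bij norm_inv_ge norm_inv_le neumann_sums
      neumann_error_le[of "Suc n" for n]
    by (simp add: lessThan_Suc_atMost)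
qed

end
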